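(* Let $\dot G$ be a signed graph with spectrum $\{[-\lambda]^{m-2},[-1]^1,[1]^1,[\lambda]^{m-2}\}$. Suppose every vertex of its underlying graph $G$ has degree $\lambda^2$, $\lambda^2-1$, or $\lambda^2-2$, and at least one vertex has degree $\lambda^2-1$. Then there is a signed graph $\dot H$ with spectrum $\{[-\lambda]^{m-1},[0]^1,[\lambda]^{m-1}\}$, all of whose vertices have degree $\lambda^2$ or $\lambda^2-1$, containing a vertex whose deletion yields $\dot G$.
   Context: A signed graph $\dot G=(G,\sigma)$ consists of a simple graph $G$ and $\sigma:E(G)\to\{1,-1\}$; its adjacency matrix is that of $G$ with entries of negative edges replaced by $-1$, and its spectrum is the multiset of eigenvalues of this matrix. The degree of a vertex is its degree in the underlying graph. The notation $[\mu]^k$ means eigenvalue $\mu$ with multiplicity $k$. *)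

theory Defs
  imports "Jordan_Normal_Form.Char_Poly"
begin

record 'a signed_graph =
  verts :: "'a set"
  edges :: "'a set set"
  edge_sign :: "'a set \<Rightarrow> int"

text \<open>The values of \<^const>\<open>edge_sign\<close> outside of the edge set are irrelevant.\<close>

definition signed_graph :: "'a signed_graph \<Rightarrow> bool" where
  "signed_graph G \<longleftrightarrow>
     finite (verts G) \<and>
     (\<forall>e\<in>edges G. e \<subseteq> verts G \<and> card e = 2) \<and>
     (\<forall>e\<in>edges G. edge_sign G e \<in> {1, -1})"

definition vertex_degree :: "'a signed_graph \<Rightarrow> 'a \<Rightarrow> nat" where
  "vertex_degree G v = card {e \<in> edges G. v \<in> e}"

definition adj_entry :: "'a signed_graph \<Rightarrow> 'a \<Rightarrow> 'a \<Rightarrow> real" where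
  "adj_entry G u v = (if {u, v} \<in> edges G then of_int (edge_sign G {u, v}) else 0)"

definition adj_mat :: "'a signed_graph \<Rightarrow> 'a list \<Rightarrow> real mat" where
  "adj_mat G vs = mat (length vs) (length vs) (\<lambda>(i, j). adj_entry G (vs ! i) (vs ! j))"

text \<open>
  The spectrum is the multiset of roots of the characteristic polynomial. The adjacency matrix is
  real symmetric, so all of its complex eigenvalues occur among the real roots. The ordering
  of the vertices is immaterial, see \<open>graph_spectrum_eq\<close> below.
\<close>

definition graph_spectrum :: "'a signed_graph \<Rightarrow> real multiset" where
  "graph_spectrum G =
     proots (char_poly (adj_mat G (SOME vs. distinct vs \<and> set vs = verts G)))"

definition delete_vertex :: "'a \<Rightarrow> 'a signed_graph \<Rightarrow> 'a signed_graph" where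
  "delete_vertex v G =
     \<lparr>verts = verts G - {v}, edges = {e \<in> edges G. v \<notin> e}, edge_sign = edge_sign G\<rparr>"

text \<open>Isomorphism preserves all signs; no switching is allowed.\<close>

definition isomorphic :: "'a signed_graph \<Rightarrow> 'b signed_graph \<Rightarrow> bool" where
  "isomorphic G H \<longleftrightarrow>
     (\<exists>f. bij_betw f (verts G) (verts H) \<and>
          edges H = (\<lambda>e. f ` e) ` edges G \<and>
          (\<forall>e\<in>edges G. edge_sign H (f ` e) = edge_sign G e))"

lemma adj_mat_similar:
  assumes "distinct vs" "distinct ws" "set vs = set ws"
  shows "similar_mat (adj_mat G vs) (adj_mat G ws)"
proof -
  define n where "n = length vs"
  have n: "length vs = n" "length ws = n"
    using assms by (auto simp: n_def dest!: distinct_card)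
  define P :: "real mat" where "P = mat n n (\<lambda>(i, j). if vs ! i = ws ! j then 1 else 0)"
  define Q :: "real mat" where "Q = mat n n (\<lambda>(i, j). if ws ! i = vs ! j then 1 else 0)"
  have ex: "\<exists>k<n. ws ! k = vs ! i" "\<exists>k<n. vs ! k = ws ! i" if "i < n" for i
    using that assms(3) n by (metis in_set_conv_nth)+
  have delta: "(\<Sum>k\<in>{0..<n}. (if us ! k = x then 1 else 0) * (g k :: real)) = g j"
    if "j < n" "us ! j = x" "distinct us" "length us = n" for us :: "'a list" and x g j
  proof -
    have "(\<Sum>k\<in>{0..<n}. (if us ! k = x then 1 else 0) * g k) = (\<Sum>k\<in>{0..<n}. if k = j then g k else 0)"
      by (rule sum.cong) (use that in \<open>auto simp: nth_eq_iff_index_eq\<close>)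
    thus ?thesis using that by simp
  qed
  have PQ: "P * Q = 1\<^sub>m n"
  proof (rule eq_matI)
    fix i j assume "i < dim_row (1\<^sub>m n :: real mat)" "j < dim_col (1\<^sub>m n :: real mat)"
    hence ij: "i < n" "j < n" by auto
    obtain k where k: "k < n" "ws ! k = vs ! i" using ex ij by blast
    have "(P * Q) $$ (i, j) =
        (\<Sum>k\<in>{0..<n}. (if ws ! k = vs ! i then 1 else 0) * (if ws ! k = vs ! j then 1 else 0))"
      using ij by (auto simp: P_def Q_def scalar_prod_def intro!: sum.cong)
    also have "\<dots> = (if ws ! k = vs ! j then 1 else 0)"
      by (rule delta) (use k assms n in auto)
    finally show "(P * Q) $$ (i, j) = (1\<^sub>m n :: real mat) $$ (i, j)"
      using ij k assms n by (simp add: nth_eq_iff_index_eq)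
  qed (auto simp: P_def Q_def)
  have QP: "Q * P = 1\<^sub>m n"
  proof (rule eq_matI)
    fix i j assume "i < dim_row (1\<^sub>m n :: real mat)" "j < dim_col (1\<^sub>m n :: real mat)"
    hence ij: "i < n" "j < n" by auto
    obtain k where k: "k < n" "vs ! k = ws ! i" using ex ij by blast
    have "(Q * P) $$ (i, j) =
        (\<Sum>k\<in>{0..<n}. (if vs ! k = ws ! i then 1 else 0) * (if vs ! k = ws ! j then 1 else 0))"
      using ij by (auto simp: P_def Q_def scalar_prod_def intro!: sum.cong)
    also have "\<dots> = (if vs ! k = ws ! j then 1 else 0)"
      by (rule delta) (use k assms n in auto)
    finally show "(Q * P) $$ (i, j) = (1\<^sub>m n :: real mat) $$ (i, j)"
      using ij k assms n by (simp add: nth_eq_iff_index_eq)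
  qed (auto simp: P_def Q_def)
  have AP: "adj_mat G vs * P = P * adj_mat G ws"
  proof (rule eq_matI)
    fix i j
    assume "i < dim_row (P * adj_mat G ws)" "j < dim_col (P * adj_mat G ws)"
    hence ij: "i < n" "j < n" by (auto simp: P_def adj_mat_def n)
    obtain k where k: "k < n" "vs ! k = ws ! j" using ex ij by blast
    obtain l where l: "l < n" "ws ! l = vs ! i" using ex ij by blast
    have "(adj_mat G vs * P) $$ (i, j) =
        (\<Sum>k\<in>{0..<n}. (if vs ! k = ws ! j then 1 else 0) * adj_entry G (vs ! i) (vs ! k))"
      using ij by (auto simp: P_def adj_mat_def n scalar_prod_def intro!: sum.cong)
    also have "\<dots> = adj_entry G (vs ! i) (vs ! k)"
      by (rule delta) (use k assms n in auto)
    also have "\<dots> = adj_entry G (ws ! l) (ws ! j)"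
      by (simp add: k l)
    also have "\<dots> = (\<Sum>l\<in>{0..<n}. (if ws ! l = vs ! i then 1 else 0) * adj_entry G (ws ! l) (ws ! j))"
      by (rule delta [symmetric]) (use l assms n in auto)
    also have "\<dots> = (P * adj_mat G ws) $$ (i, j)"
      using ij by (auto simp: P_def adj_mat_def n scalar_prod_def intro!: sum.cong)
    finally show "(adj_mat G vs * P) $$ (i, j) = (P * adj_mat G ws) $$ (i, j)" .
  qed (auto simp: P_def adj_mat_def n)
  have car: "adj_mat G vs \<in> carrier_mat n n" "adj_mat G ws \<in> carrier_mat n n"
      "P \<in> carrier_mat n n" "Q \<in> carrier_mat n n"
    by (auto simp: P_def Q_def adj_mat_def n)
  have "P * adj_mat G ws * Q = adj_mat G vs * (P * Q)"
    using car by (simp add: AP [symmetric])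
  hence "adj_mat G vs = P * adj_mat G ws * Q"
    using PQ car by simp
  thus ?thesis
    using PQ QP car by (intro similar_matI [of _ _ P Q n]) auto
qed

lemma graph_spectrum_eq:
  assumes "distinct vs" "set vs = verts G"
  shows "graph_spectrum G = proots (char_poly (adj_mat G vs))"
proof -
  define ws where "ws = (SOME vs. distinct vs \<and> set vs = verts G)"
  have "distinct ws \<and> set ws = verts G"
    unfolding ws_def by (rule someI [of _ vs]) (use assms in simp)
  hence "similar_mat (adj_mat G ws) (adj_mat G vs)"
    using assms by (intro adj_mat_similar) auto
  thus ?thesis
    unfolding graph_spectrum_def ws_def [symmetric] by (simp add: char_poly_similar)
qed

end

theory Submission
  imports Defs "Jordan_Normal_Form.Schur_Decomposition"
begin

text \<open>
  Let \<open>A\<close> be the adjacency matrix, \<open>k = \<lambda>\<^sup>2 - 1\<close> and \<open>M = \<lambda>\<^sup>2 I - A\<^sup>2\<close>. The spectrum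
  gives \<open>M\<^sup>2 = k M\<close>, \<open>A\<^sup>2 M = M\<close> and \<open>tr M = 2 k\<close>, and a vertex \<open>v\<close> of degree \<open>k\<close>
  has \<open>M\<^sub>v\<^sub>v = 1\<close>. Let \<open>y\<close> be the column \<open>v\<close> of \<open>M\<close> and \<open>z = A y\<close>; both are integral of
  squared norm \<open>k\<close>, and \<open>A z = y\<close>. Now \<open>y \<bullet> z = k (M A)\<^sub>v\<^sub>v = - k (A\<^sup>3)\<^sub>v\<^sub>v\<close>, where
  \<open>(A\<^sup>3)\<^sub>v\<^sub>v\<close> is even because \<open>A\<close> is integral and symmetric with zero diagonal, and at most \<open>1\<close> in
  absolute value by the Cauchy--Schwarz inequality. Hence \<open>y\<close> and \<open>z\<close> are orthogonal and
  \<open>M = y y\<^sup>T + z z\<^sup>T\<close>. The diagonal entries of \<open>M\<close> being at most \<open>2\<close>, the entries of \<open>y\<close>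
  and \<open>z\<close> lie in \<open>{0, 1, -1}\<close>. Join a new vertex to \<open>G\<close> by means of \<open>y\<close>. The adjacency matrix
  \<open>H\<close> satisfies \<open>\<lambda>\<^sup>2 I - H\<^sup>2 = w w\<^sup>T\<close> with \<open>w = (z, -1)\<close> and \<open>H w = 0\<close>, so that
  \<open>H\<^sup>3 = \<lambda>\<^sup>2 H\<close>, and the multiplicities follow from the traces of \<open>H\<close> and \<open>H\<^sup>2\<close>.
\<close>

subsection \<open>Polynomials in a matrix and the spectrum\<close>

definition trace_mat :: "'a :: comm_ring_1 mat \<Rightarrow> 'a" where
  "trace_mat A = (\<Sum>i<dim_row A. A $$ (i, i))"

lemma index_mult_mat_sum:
  assumes "A \<in> carrier_mat n n" "B \<in> carrier_mat n n" "i < n" "j < n"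
  shows "(A * B) $$ (i, j) = (\<Sum>l<n. A $$ (i, l) * B $$ (l, j))"
  using assms by (auto simp: scalar_prod_def lessThan_atLeast0 intro!: sum.cong)

lemma trace_mat_comm:
  assumes "A \<in> carrier_mat n n" "B \<in> carrier_mat n n"
  shows "trace_mat (A * B) = trace_mat (B * A)"
proof -
  have "trace_mat (A * B) = (\<Sum>i<n. \<Sum>l<n. A $$ (i, l) * B $$ (l, i))"
    using assms by (auto simp: trace_mat_def index_mult_mat_sum simp del: index_mult_mat(1))
  also have "\<dots> = (\<Sum>l<n. \<Sum>i<n. B $$ (l, i) * A $$ (i, l))"
    by (subst sum.swap) (simp add: mult.commute)
  also have "\<dots> = trace_mat (B * A)"
    using assms by (auto simp: trace_mat_def index_mult_mat_sum simp del: index_mult_mat(1))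
  finally show ?thesis .
qed

definition poly_mat :: "'a :: comm_ring_1 poly \<Rightarrow> 'a mat \<Rightarrow> 'a mat" where
  "poly_mat p A = fold_coeffs (\<lambda>a B. a \<cdot>\<^sub>m 1\<^sub>m (dim_row A) + A * B) p (0\<^sub>m (dim_row A) (dim_row A))"

context
  fixes A :: "'a :: comm_ring_1 mat" and n :: nat
  assumes A: "A \<in> carrier_mat n n"
begin

lemma poly_mat_0: "poly_mat 0 A = 0\<^sub>m n n"
  using A by (auto simp: poly_mat_def)

text \<open>The Horner recursion of \<open>fold_coeffs\<close> skips \<open>pCons 0 0\<close>, whose
  coefficient list is empty. In that case both sides are the zero matrix.\<close>

lemma poly_mat_pCons: "poly_mat (pCons a p) A = a \<cdot>\<^sub>m 1\<^sub>m n + A * poly_mat p A"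
proof (cases "p = 0 \<and> a = 0")
  case True
  have "poly_mat 0 A = 0 \<cdot>\<^sub>m 1\<^sub>m n + A * poly_mat 0 A"
    unfolding poly_mat_0 using A by (auto intro!: eq_matI)
  with True show ?thesis by simp
next
  case False
  then show ?thesis using A by (auto simp: poly_mat_def)
qed

lemma poly_mat_carrier: "poly_mat p A \<in> carrier_mat n n"
  by (induction p) (use A in \<open>auto simp: poly_mat_0 poly_mat_pCons\<close>)

lemma poly_mat_add: "poly_mat (p + q) A = poly_mat p A + poly_mat q A"
proof (induction p q rule: poly_induct2)
  case 0
  then show ?case by (simp add: poly_mat_0)
next
  case (pCons a p b q)
  note c = poly_mat_carrier [of p] poly_mat_carrier [of q]
  show ?case
    unfolding add_pCons poly_mat_pCons pCons.IH mult_add_distrib_mat [OF A c]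
    by (rule eq_matI) (use A c in \<open>auto simp: algebra_simps simp del: index_mult_mat(1)\<close>)
qed

lemma poly_mat_smult: "poly_mat (Polynomial.smult c p) A = c \<cdot>\<^sub>m poly_mat p A"
proof (induction p)
  case 0
  then show ?case by (simp add: poly_mat_0)
next
  case (pCons a p)
  note q = poly_mat_carrier [of p]
  show ?case
    unfolding smult_pCons poly_mat_pCons pCons.IH mult_smult_distrib [OF A q]
    by (rule eq_matI) (use A q in \<open>auto simp: algebra_simps simp del: index_mult_mat(1)\<close>)
qed

lemma poly_mat_mult: "poly_mat (p * q) A = poly_mat p A * poly_mat q A"
proof (induction p)
  case 0
  then show ?case using poly_mat_carrier [of q] by (simp add: poly_mat_0)
next
  case (pCons a p)
  note c = poly_mat_carrier [of p] poly_mat_carrier [of q]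
  have "poly_mat (pCons a p * q) A = a \<cdot>\<^sub>m poly_mat q A + A * (poly_mat p A * poly_mat q A)"
    using A c by (auto simp: poly_mat_add poly_mat_smult poly_mat_pCons pCons.IH intro!: eq_matI
        simp del: index_mult_mat(1))
  also have "\<dots> = (a \<cdot>\<^sub>m 1\<^sub>m n + A * poly_mat p A) * poly_mat q A"
    using A c by (subst add_mult_distrib_mat [of _ n n]) auto
  finally show ?case by (simp add: poly_mat_pCons)
qed

lemma poly_mat_X: "poly_mat [:0, 1:] A = A"
  using A by (auto simp: poly_mat_pCons poly_mat_0 intro!: eq_matI)

lemma poly_mat_const: "poly_mat [:c:] A = c \<cdot>\<^sub>m 1\<^sub>m n"
  using A by (auto simp: poly_mat_pCons poly_mat_0 intro!: eq_matI)

text \<open>In a product of upper triangular matrices, an entry on or below the diagonal receives a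
  nonzero term only if both outer indices and the summation index coincide. Diagonals therefore
  multiply entrywise.\<close>

lemma poly_mat_upper_triangular:
  assumes "upper_triangular A"
  shows "upper_triangular (poly_mat p A) \<and> (\<forall>i<n. poly_mat p A $$ (i, i) = poly p (A $$ (i, i)))"
proof (induction p)
  case 0
  then show ?case by (simp add: poly_mat_0)
next
  case (pCons a p)
  note q = poly_mat_carrier [of p]
  have ut: "A $$ (i, l) * poly_mat p A $$ (l, j) =
      (if i = j \<and> l = i then A $$ (i, i) * poly p (A $$ (i, i)) else 0)"
    if "j \<le> i" "i < n" "l < n" for i j l
  proof -
    have "l < i \<or> l = i \<and> j = i \<or> j < l"
      using that by arith
    then show ?thesis
      by (elim disjE) (use that A q assms pCons.IH in \<open>auto simp: upper_triangular_def\<close>)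
  qed
  have "(A * poly_mat p A) $$ (i, j) = (if i = j then A $$ (i, i) * poly p (A $$ (i, i)) else 0)"
    if "j \<le> i" "i < n" for i j
  proof -
    have "(A * poly_mat p A) $$ (i, j) =
        (\<Sum>l<n. if i = j \<and> l = i then A $$ (i, i) * poly p (A $$ (i, i)) else 0)"
      using that by (simp add: index_mult_mat_sum [OF A q] ut del: index_mult_mat(1))
    then show ?thesis
      using that by auto
  qed
  then show ?case
    unfolding poly_mat_pCons using A q
    by (auto simp: upper_triangular_def simp del: index_mult_mat(1))
qed

end

lemma poly_mat_similar:
  assumes A: "A \<in> carrier_mat n n" and sim: "similar_mat_wit A B P Q"
  shows "poly_mat p A = P * poly_mat p B * Q"
proof (induction p)
  note w = similar_mat_witD2 [OF A sim]
  case 0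
  then show ?case using w by (simp add: poly_mat_0 [of _ n])
next
  note w = similar_mat_witD2 [OF A sim]
  case (pCons a p)
  have B: "poly_mat p B \<in> carrier_mat n n"
    using w by (intro poly_mat_carrier)
  have QP: "Q * (P * X) = X" if "X \<in> carrier_mat n n" for X
    using w(1,2,4-) that by (simp flip: assoc_mult_mat [of Q n n P n X n])
  note [simp] = assoc_mult_mat [of _ n n _ n _ n]
  \<comment> \<open>Expanding \<open>A\<close> as \<open>P * B * Q\<close> leaves an inner factor
    \<open>Q * P\<close>, which cancels.\<close>
  have eq: "A * (P * poly_mat p B * Q) = P * (B * poly_mat p B) * Q"
    using w(4-7) B by (subst w(3)) (simp add: QP)
  have "a \<cdot>\<^sub>m 1\<^sub>m n + A * (P * poly_mat p B * Q) = P * (a \<cdot>\<^sub>m 1\<^sub>m n) * Q + P * (B * poly_mat p B) * Q"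
    unfolding eq using w(1,4-) B by (simp add: mult_smult_distrib [of _ n n _ n] mult_smult_assoc_mat [of _ n n _ n])
  also have "\<dots> = P * (a \<cdot>\<^sub>m 1\<^sub>m n + B * poly_mat p B) * Q"
    using w B by (simp add: mult_add_distrib_mat [of _ n n _ n] add_mult_distrib_mat [of _ n n _ _ n])
  finally show ?case
    by (simp only: poly_mat_pCons [OF A] poly_mat_pCons [OF w(5)] pCons.IH)
qed

text \<open>A Schur decomposition makes \<open>A\<close> similar to an upper triangular matrix with
  diagonal \<open>es\<close>. Evaluating \<open>p\<close> acts on that diagonal entrywise, and the
  trace is invariant under similarity.\<close>

lemma trace_poly_mat:
  fixes A :: "'a :: conjugatable_ordered_field mat"
  assumes A: "A \<in> carrier_mat n n" and es: "char_poly A = (\<Prod>e\<leftarrow>es. [:- e, 1:])"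
  shows "trace_mat (poly_mat p A) = (\<Sum>e\<leftarrow>es. poly p e)"
proof -
  obtain B P Q where s: "schur_decomposition A es = (B, P, Q)"
    by (cases "schur_decomposition A es") auto
  note sc = schur_decomposition [OF A es s]
  note w = similar_mat_witD2 [OF A, of B P Q]
  have c: "P \<in> carrier_mat n n" "Q \<in> carrier_mat n n" "B \<in> carrier_mat n n"
     "poly_mat p B \<in> carrier_mat n n"
    using sc w poly_mat_carrier by auto
  have "trace_mat (poly_mat p A) = trace_mat (P * poly_mat p B * Q)"
    using poly_mat_similar [OF A] sc by metis
  also have "\<dots> = trace_mat (Q * (P * poly_mat p B))"
    using c by (intro trace_mat_comm) auto
  also have "Q * (P * poly_mat p B) = Q * P * poly_mat p B"
    using c by (simp add: assoc_mult_mat [of _ n n _ n _ n])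
  also have "\<dots> = poly_mat p B"
    using w sc c by simp
  also have "trace_mat (poly_mat p B) = (\<Sum>i<n. poly p (B $$ (i, i)))"
    using c poly_mat_upper_triangular [OF c(3)] sc by (simp add: trace_mat_def)
  also have "\<dots> = (\<Sum>e\<leftarrow>diag_mat B. poly p e)"
    using c by (simp add: diag_mat_def sum_list_sum_nth lessThan_atLeast0)
  finally show ?thesis using sc by simp
qed

section \<open>Real spectra of symmetric matrices, and identities tested on the spectrum\<close>

lemma map_poly_of_real_linear_factors:
  "map_poly complex_of_real (\<Prod>e\<leftarrow>es. [:- e, 1:]) = (\<Prod>e\<leftarrow>es. [:- complex_of_real e, 1:])"
proof (induction es)
  case (Cons e es)
  have "map_poly complex_of_real ([:- e, 1:] * p) = [:- complex_of_real e, 1:] * map_poly complex_of_real p" for p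
    by (intro poly_eqI) (simp add: coeff_pCons split: nat.split)
  with Cons show ?case by (simp only: list.map prod_list.Cons)
qed simp

text \<open>Over the complex numbers the characteristic polynomial splits, so it suffices that each
  root is real. This follows from evaluating the Hermitian form of \<open>A\<close> at an
  eigenvector.\<close>

lemma symmetric_char_poly_splits:
  fixes A :: "real mat"
  assumes A: "A \<in> carrier_mat n n" and sym: "\<And>i j. i < n \<Longrightarrow> j < n \<Longrightarrow> A $$ (i, j) = A $$ (j, i)"
  shows "\<exists>es. char_poly A = (\<Prod>e\<leftarrow>es. [:- e, 1:])"
proof -
  define C where "C = map_mat complex_of_real A"
  have C: "C \<in> carrier_mat n n" using A by (simp add: C_def)
  obtain cs where cs: "char_poly C = (\<Prod>a\<leftarrow>cs. [:- a, 1:])"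
    using char_poly_factorized [OF C] by blast
  have "Im c = 0" if "c \<in> set cs" for c
  proof -
    have "poly (char_poly C) c = 0"
      using that unfolding cs by (auto simp: poly_prod_list prod_list_zero_iff)
    then have "eigenvalue C c" using eigenvalue_root_char_poly [OF C] by simp
    then obtain v where v: "v \<in> carrier_vec n" "v \<noteq> 0\<^sub>v n" "C *\<^sub>v v = c \<cdot>\<^sub>v v"
      using C unfolding eigenvalue_def eigenvector_def by auto
    have Cv: "(\<Sum>j<n. of_real (A $$ (i, j)) * v $ j) = c * v $ i" if "i < n" for i
      using that A v(1) arg_cong [OF v(3), of "\<lambda>w. w $ i"]
      by (auto simp: C_def scalar_prod_def lessThan_atLeast0 intro!: sum.cong elim!: trans [rotated])
    \<comment> \<open>\<open>S\<close> is the value of the Hermitian form at the eigenvector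
      \<open>v\<close>. It equals \<open>c * N\<close>, and it is its own conjugate by symmetry of
      \<open>A\<close>; since \<open>N > 0\<close>, the eigenvalue \<open>c\<close> is real.\<close>
    define N where "N = (\<Sum>i<n. (cmod (v $ i))^2)"
    define S where "S = (\<Sum>i<n. \<Sum>j<n. cnj (v $ i) * of_real (A $$ (i, j)) * v $ j)"
    have "S = (\<Sum>i<n. cnj (v $ i) * (\<Sum>j<n. of_real (A $$ (i, j)) * v $ j))"
      unfolding S_def by (simp add: sum_distrib_left mult.assoc)
    also have "\<dots> = (\<Sum>i<n. c * of_real ((cmod (v $ i))^2))"
      by (intro sum.cong refl, subst Cv) (auto simp: complex_norm_square simp flip: of_real_power)
    also have "\<dots> = c * of_real N"
      unfolding N_def by (simp add: sum_distrib_left)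
    finally have S: "S = c * of_real N" .
    have "cnj S = (\<Sum>i<n. \<Sum>j<n. v $ i * of_real (A $$ (i, j)) * cnj (v $ j))"
      unfolding S_def by simp
    also have "\<dots> = (\<Sum>j<n. \<Sum>i<n. v $ i * of_real (A $$ (i, j)) * cnj (v $ j))"
      by (rule sum.swap)
    also have "\<dots> = S"
      unfolding S_def by (intro sum.cong refl) (simp add: sym algebra_simps)
    finally have "Im S = 0" by (metis cnj.simps(2) equal_neg_zero)
    obtain i where i: "i < n" "v $ i \<noteq> 0"
      using v(1,2) by (metis carrier_vecD eq_vecI index_zero_vec)
    have "N > 0"
      unfolding N_def by (rule sum_pos2 [of _ i]) (use i in auto)
    with S \<open>Im S = 0\<close> show ?thesis by simp
  qed
  then have cs_re: "cs = map (complex_of_real \<circ> Re) cs"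
    by (auto simp: complex_eq_iff intro!: map_idI [symmetric])
  define es where "es = map Re cs"
  have "map_poly complex_of_real (char_poly A) = char_poly C"
    unfolding C_def by (rule of_real_hom.char_poly_hom [symmetric]) (fact A)
  also have "\<dots> = (\<Prod>e\<leftarrow>es. [:- complex_of_real e, 1:])"
    unfolding cs es_def by (subst cs_re) (simp add: o_def)
  also have "\<dots> = map_poly complex_of_real (\<Prod>e\<leftarrow>es. [:- e, 1:])"
    by (rule map_poly_of_real_linear_factors [symmetric])
  finally have "char_poly A = (\<Prod>e\<leftarrow>es. [:- e, 1:])"
    by (metis of_real_hom.coeff_map_poly_hom of_real_eq_iff poly_eqI)
  then show ?thesis by blast
qed

lemma poly_mat_symmetric:
  assumes A: "A \<in> carrier_mat n n" and sym: "transpose_mat A = A"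
  shows "transpose_mat (poly_mat p A) = poly_mat p A"
proof (induction p)
  case 0
  then show ?case by (simp add: poly_mat_0 [OF A])
next
  case (pCons a p)
  note c = poly_mat_carrier [OF A, of p]
  have "transpose_mat (A * poly_mat p A) = poly_mat p A * poly_mat [:0, 1:] A"
    using transpose_mult [OF A c] by (simp add: sym pCons.IH poly_mat_X [OF A])
  also have "\<dots> = A * poly_mat p A"
    using poly_mat_mult [OF A, of p "[:0, 1:]"] poly_mat_mult [OF A, of "[:0, 1:]" p]
    by (simp add: mult.commute poly_mat_X [OF A])
  finally have "transpose_mat (A * poly_mat p A) = A * poly_mat p A" .
  moreover have "transpose_mat (a \<cdot>\<^sub>m 1\<^sub>m n) = a \<cdot>\<^sub>m 1\<^sub>m n"
    by (auto intro!: eq_matI)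
  ultimately show ?case
    using A c by (simp add: poly_mat_pCons [OF A] transpose_add [of _ n n])
qed

text \<open>By symmetry the trace of \<open>B * B\<close> is the sum of the squares of all entries
  of \<open>B\<close>.\<close>

lemma symmetric_trace_square_eq_0:
  fixes B :: "real mat"
  assumes B: "B \<in> carrier_mat n n" and sym: "transpose_mat B = B" and tr: "trace_mat (B * B) = 0"
  shows "B = 0\<^sub>m n n"
proof -
  have s: "B $$ (l, i) = B $$ (i, l)" if "i < n" "l < n" for i l
    using that B arg_cong [OF sym, of "\<lambda>M. M $$ (i, l)"] by simp
  have "0 = (\<Sum>i<n. \<Sum>l<n. (B $$ (i, l))^2)"
    using B tr by (simp add: trace_mat_def index_mult_mat_sum s power2_eq_square del: index_mult_mat(1))
  then have "B $$ (i, l) = 0" if "i < n" "l < n" for i l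
    using that by (simp add: sum_nonneg_eq_0_iff sum_nonneg)
  then show ?thesis using B by auto
qed

context
  fixes A :: "real mat" and n :: nat
  assumes A: "A \<in> carrier_mat n n" and sym: "transpose_mat A = A"
begin

text \<open>As the characteristic polynomial splits over the reals, \<open>proots\<close> captures
  the whole spectrum. This is the bridge between spectra and matrices: spectral data enter and leave
  only through traces of polynomials in \<open>A\<close>.\<close>

lemma trace_poly_mat_proots:
  "trace_mat (poly_mat p A) = (\<Sum>e\<in>#proots (char_poly A). poly p e)"
proof -
  have "A $$ (i, j) = A $$ (j, i)" if "i < n" "j < n" for i j
    using that A arg_cong [OF sym, of "\<lambda>M. M $$ (i, j)"] by simp
  then obtain es where es: "char_poly A = (\<Prod>e\<leftarrow>es. [:- e, 1:])"
    using symmetric_char_poly_splits [OF A] by blast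
  have "proots (char_poly A) = mset es"
    unfolding es
  proof (induction es)
    case (Cons e es)
    have "(\<Prod>e\<leftarrow>es. [:- e, 1:]) \<noteq> 0"
      by (auto simp: prod_list_zero_iff)
    then show ?case
      by (simp add: proots_mult Cons.IH del: mult_pCons_left)
  qed simp
  then show ?thesis
    using trace_poly_mat [OF A es] by (metis mset_map sum_mset_sum_list)
qed

text \<open>This is the trace formula for the constant polynomial 1.\<close>

lemma size_proots_char_poly: "size (proots (char_poly A)) = n"
proof -
  have "trace_mat (poly_mat [:1:] A) = real n"
    using A by (simp add: poly_mat_const [OF A] trace_mat_def)
  then have "real (size (proots (char_poly A))) = real n"
    by (simp add: trace_poly_mat_proots)
  then show ?thesis by (simp only: of_nat_eq_iff)
qed

text \<open>The trace of the square of \<open>poly_mat p A\<close> is a sum of zeros, and the matrix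
  is symmetric. This takes the place of an orthogonal diagonalisation.\<close>

lemma poly_mat_eq_0:
  assumes "\<And>e. e \<in># proots (char_poly A) \<Longrightarrow> poly p e = 0"
  shows "poly_mat p A = 0\<^sub>m n n"
proof (rule symmetric_trace_square_eq_0)
  have "trace_mat (poly_mat p A * poly_mat p A) = (\<Sum>e\<in>#proots (char_poly A). poly (p * p) e)"
    by (simp only: trace_poly_mat_proots flip: poly_mat_mult [OF A])
  also have "\<dots> = 0"
    using assms by (intro sum_mset.neutral) auto
  finally show "trace_mat (poly_mat p A * poly_mat p A) = 0" .
qed (use A sym poly_mat_carrier poly_mat_symmetric in blast)+

lemma poly_mat_eqI:
  assumes "\<And>e. e \<in># proots (char_poly A) \<Longrightarrow> poly p e = poly q e"
  shows "poly_mat p A = poly_mat q A"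
proof -
  have "poly_mat ((p - q) + q) A = 0\<^sub>m n n + poly_mat q A"
    using poly_mat_eq_0 [of "p - q"] assms by (simp only: poly_mat_add [OF A]) simp
  then show ?thesis using poly_mat_carrier [OF A, of q] by simp
qed

end

subsection \<open>Symmetric matrices whose square has a rank two complement\<close>

text \<open>The terms at \<open>(i, j)\<close> and \<open>(j, i)\<close> pair up, and the diagonal
  contributes nothing.\<close>

lemma even_symmetric_sum:
  fixes f :: "'b \<Rightarrow> 'b \<Rightarrow> int"
  assumes "finite S" "\<And>i j. i \<in> S \<Longrightarrow> j \<in> S \<Longrightarrow> f i j = f j i" "\<And>i. i \<in> S \<Longrightarrow> f i i = 0"
  shows "even (\<Sum>i\<in>S. \<Sum>j\<in>S. f i j)"
  using assms
proof (induction S rule: finite_induct)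
  case (insert x S)
  have "(\<Sum>i\<in>insert x S. \<Sum>j\<in>insert x S. f i j) =
      f x x + (\<Sum>j\<in>S. f x j) + (\<Sum>i\<in>S. f i x) + (\<Sum>i\<in>S. \<Sum>j\<in>S. f i j)"
    using insert.hyps by (simp add: sum.distrib)
  also have "(\<Sum>i\<in>S. f i x) = (\<Sum>j\<in>S. f x j)"
    using insert.prems by (intro sum.cong) auto
  finally show ?case
    using insert.IH insert.prems by simp
qed simp

text \<open>Here \<open>L\<close> stands for the square of \<lambda>, and \<open>v\<close> for a
  vertex of degree \<open>L - 1\<close>. The conclusion collects what is needed to border
  \<open>A\<close> by \<open>y\<close>; that \<open>y\<close> and \<open>z\<close> are integral
  matters, because \<open>y\<close> will supply the signs of the new edges.\<close>

lemma rank_two_complement_of_square: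
  fixes A :: "real mat" and a :: "nat \<Rightarrow> nat \<Rightarrow> int"
  assumes A: "A \<in> carrier_mat n n" and sym: "transpose_mat A = A"
    and int: "\<And>i j. i < n \<Longrightarrow> j < n \<Longrightarrow> A $$ (i, j) = of_int (a i j)"
    and diag: "\<And>i. i < n \<Longrightarrow> A $$ (i, i) = 0"
    and spec: "\<And>e. e \<in># proots (char_poly A) \<Longrightarrow> e^2 = L \<or> e^2 = 1"
    and tr: "(\<Sum>e\<in>#proots (char_poly A). L - e^2) = 2 * (L - 1)"
    and v: "v < n" "(A * A) $$ (v, v) = L - 1"
  obtains y z :: "nat \<Rightarrow> int" where
    "\<And>i j. i < n \<Longrightarrow> j < n \<Longrightarrow>
      (\<Sum>l<n. A $$ (i, l) * A $$ (l, j)) = (if i = j then L else 0) - y i * y j - z i * z j"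
    "\<And>i. i < n \<Longrightarrow> (\<Sum>l<n. A $$ (i, l) * y l) = z i"
    "\<And>i. i < n \<Longrightarrow> (\<Sum>l<n. A $$ (i, l) * z l) = y i"
    "(\<Sum>i<n. (of_int (y i))^2) = L - 1"
    "(\<Sum>i<n. (of_int (z i))^2) = L - 1"
    "(\<Sum>i<n. y i * z i) = 0"
    "L > 1"
proof -
  \<comment> \<open>Polynomials in \<open>A\<close> are handled through their entries, so that
    matrix identities reduce to identities in the commutative ring of polynomials, modulo vanishing
    on the spectrum.\<close>
  define E where "E p i j = poly_mat p A $$ (i, j)" for p i j
  have E_mult: "E (p * q) i j = (\<Sum>l<n. E p i l * E q l j)" if "i < n" "j < n" for p q i j
    using that unfolding E_def poly_mat_mult [OF A]
    by (intro index_mult_mat_sum poly_mat_carrier A)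
  have E_sym: "E p i j = E p j i" if "i < n" "j < n" for p i j
    using that poly_mat_carrier [OF A, of p] arg_cong [OF poly_mat_symmetric [OF A sym, of p], of "\<lambda>M. M $$ (i, j)"]
    by (simp add: E_def)
  have E_X: "E [:0, 1:] i j = A $$ (i, j)" for i j
    by (simp add: E_def poly_mat_X [OF A])
  have E_smult: "E (Polynomial.smult c p) i j = c * E p i j" if "i < n" "j < n" for c p i j
    using that poly_mat_carrier [OF A, of p] by (simp add: E_def poly_mat_smult [OF A])
  have E_eqI: "E p = E q" if "\<And>e. e^2 = L \<or> e^2 = 1 \<Longrightarrow> poly p e = poly q e" for p q
    using poly_mat_eqI [OF A sym, of p q] spec that by (auto simp: E_def fun_eq_iff)
  \<comment> \<open>On the spectrum, \<open>Mp\<close> is 0 where \<open>e^2 = L\<close> and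
    \<open>k\<close> where \<open>e^2 = 1\<close>. Hence \<open>Mp * Mp\<close> agrees there with
    \<open>k\<close> times \<open>Mp\<close>, which is the source of the identities below.\<close>
  define k where "k = L - 1"
  define Mp where "Mp = [:L, 0, -1:]"
  define Np where "Np = [:0, 1:] * Mp"
  define M where "M = E Mp"
  define N where "N = E Np"
  have N: "N i j = (\<Sum>l<n. A $$ (i, l) * M l j)" if "i < n" "j < n" for i j
    unfolding N_def Np_def M_def by (simp only: E_mult [OF that] E_X)
  have M: "M i j = (if i = j then L else 0) - (\<Sum>l<n. A $$ (i, l) * A $$ (l, j))" if "i < n" "j < n" for i j
  proof -
    have "Mp = [:L:] + Polynomial.smult (-1) ([:0, 1:] * [:0, 1:])"
      by (simp add: Mp_def)
    then have "poly_mat Mp A = L \<cdot>\<^sub>m 1\<^sub>m n + (-1) \<cdot>\<^sub>m (A * A)"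
      by (simp only: poly_mat_add [OF A] poly_mat_smult [OF A] poly_mat_mult [OF A]
          poly_mat_X [OF A] poly_mat_const [OF A])
    then show ?thesis
      using that A
      by (simp add: M_def E_def index_mult_mat_sum [OF A A] del: index_mult_mat(1))
  qed
  have MM: "(\<Sum>l<n. M i l * M l j) = k * M i j" if "i < n" "j < n" for i j
  proof -
    have "E (Mp * Mp) = E (Polynomial.smult k Mp)"
      by (rule E_eqI) (auto simp: Mp_def k_def power2_eq_square algebra_simps)
    then show ?thesis
      using that by (simp add: M_def E_mult E_smult flip: E_mult)
  qed
  have MN: "(\<Sum>l<n. M i l * N l j) = k * N i j" if "i < n" "j < n" for i j
  proof -
    have "E (Mp * Np) = E (Polynomial.smult k Np)"
      by (rule E_eqI) (auto simp: Mp_def Np_def k_def power2_eq_square algebra_simps)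
    then show ?thesis
      using that by (simp add: M_def N_def E_mult E_smult flip: E_mult)
  qed
  have NN: "(\<Sum>l<n. N i l * N l j) = k * M i j" if "i < n" "j < n" for i j
  proof -
    have "poly (Np * Np) e = poly (Polynomial.smult k Mp) e" if "e^2 = L \<or> e^2 = 1" for e
    proof -
      have "poly (Np * Np) e = e^2 * (L - e^2)^2" "poly (Polynomial.smult k Mp) e = k * (L - e^2)"
        by (simp_all add: Np_def Mp_def power2_eq_square algebra_simps)
      with that show ?thesis by (auto simp: k_def power2_eq_square)
    qed
    then have "E (Np * Np) = E (Polynomial.smult k Mp)"
      by (rule E_eqI)
    then show ?thesis
      using that by (simp add: M_def N_def E_mult E_smult flip: E_mult)
  qed
  have AN: "(\<Sum>l<n. A $$ (i, l) * N l j) = M i j" if "i < n" "j < n" for i j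
  proof -
    \<comment> \<open>The left polynomial is \<open>e^2\<close> times \<open>Mp\<close>, and
      \<open>e^2 = 1\<close> at every eigenvalue where \<open>Mp\<close> does not vanish.\<close>
    have "E ([:0, 1:] * Np) = E Mp"
      by (rule E_eqI) (auto simp: Np_def Mp_def power2_eq_square algebra_simps)
    moreover have "E ([:0, 1:] * Np) i j = (\<Sum>l<n. A $$ (i, l) * N l j)"
      unfolding N_def by (simp only: E_mult [OF that] E_X)
    ultimately show ?thesis
      by (simp only: M_def)
  qed
  have M_sym: "M i j = M j i" and N_sym: "N i j = N j i" if "i < n" "j < n" for i j
    using that E_sym by (simp_all add: M_def N_def)
  have Mvv: "M v v = 1"
    using M [OF v(1) v(1)] v(2) A v(1) by (simp add: index_mult_mat_sum [OF A A] del: index_mult_mat(1))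
  \<comment> \<open>By symmetry of \<open>M\<close> and \<open>N\<close>, the \<open>(v, v)\<close>
    entries of \<open>MM\<close>, \<open>NN\<close> and \<open>MN\<close> are the inner products of
    these two columns; \<open>M v v = 1\<close> makes both squared norms equal to
    \<open>k\<close>.\<close>
  define y where "y i = M i v" for i
  define z where "z i = N i v" for i
  define t where "t = N v v"
  have yy: "(\<Sum>i<n. (y i)^2) = k"
    using MM [OF v(1) v(1)] v(1) M_sym [OF v(1)] by (simp add: y_def Mvv power2_eq_square)
  have zz: "(\<Sum>i<n. (z i)^2) = k"
    using NN [OF v(1) v(1)] v(1) N_sym [OF v(1)] by (simp add: z_def Mvv power2_eq_square)
  have yz: "(\<Sum>i<n. y i * z i) = k * t"
    using MN [OF v(1) v(1)] v(1) M_sym [OF v(1)] by (simp add: y_def z_def t_def)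
  \<comment> \<open>The entry \<open>y v\<close> is 1, so the squared norm \<open>k\<close> of
    \<open>y\<close> is at least 1.\<close>
  have "(y v)^2 \<le> (\<Sum>i<n. (y i)^2)"
    using v(1) by (intro member_le_sum) auto
  then have k: "k > 0"
    unfolding yy by (simp add: y_def Mvv)
  \<comment> \<open>This is the Cauchy-Schwarz inequality for \<open>y\<close> and \<open>z\<close>:
    \<open>t * y\<close> is the orthogonal projection of \<open>z\<close> to the line of
    \<open>y\<close>.\<close>
  have "0 \<le> (\<Sum>i<n. (z i - t * y i)^2)"
    by (intro sum_nonneg) simp
  also have "\<dots> = (\<Sum>i<n. (z i)^2) - 2 * t * (\<Sum>i<n. y i * z i) + t^2 * (\<Sum>i<n. (y i)^2)"
    by (simp add: sum_distrib_left power2_eq_square algebra_simps sum.distrib sum_subtractf)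
  also have "\<dots> = k * (1 - t^2)"
    unfolding yy yz zz by (simp add: power2_eq_square algebra_simps)
  finally have "t^2 \<le> 1"
    using k by (simp add: zero_le_mult_iff)
  have a_sym: "a i j = a j i" if "i < n" "j < n" for i j
    using that A arg_cong [OF sym, of "\<lambda>M. M $$ (i, j)"] by (simp add: int)
  \<comment> \<open>Although \<open>L\<close> is only given as a real number, it is an integer,
    being 1 plus an entry of the square of an integral matrix. The integrality of \<open>y\<close>
    rests on this.\<close>
  have L: "L = of_int (1 + (\<Sum>l<n. a v l * a l v))"
    using v by (simp add: index_mult_mat_sum [OF A A] int del: index_mult_mat(1))
  define T where "T = (\<Sum>i<n. \<Sum>j<n. a v i * a i j * a j v)"
  txt \<open>The entry \<open>(A\<^sup>3)\<^sub>v\<^sub>v\<close> is the value of the quadratic form of \<open>A\<close> at its own row \<open>v\<close>.\<close>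
  have "even T"
    unfolding T_def by (rule even_symmetric_sum) (use a_sym v diag int in \<open>auto simp: algebra_simps\<close>)
  \<comment> \<open>\<open>N\<close> is \<open>L\<close> times \<open>A\<close> minus the cube of
    \<open>A\<close>; at \<open>(v, v)\<close> the first part drops out because the diagonal of
    \<open>A\<close> is zero.\<close>
  have "t = (\<Sum>l<n. A $$ (v, l) * ((if l = v then L else 0) - (\<Sum>j<n. A $$ (l, j) * A $$ (j, v))))"
    unfolding t_def N [OF v(1) v(1)] by (intro sum.cong) (use M v(1) in auto)
  also have "\<dots> = (\<Sum>l<n. if l = v then A $$ (v, v) * L else 0) - of_int T"
    using v(1) by (simp add: T_def sum_distrib_left int algebra_simps sum_subtractf if_distrib [of "\<lambda>x. _ * x"] cong: if_cong)
  finally have t: "t = - of_int T"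
    using v diag by simp
  then have "(of_int (T^2) :: real) \<le> of_int 1"
    using \<open>t^2 \<le> 1\<close> by simp
  then have "T^2 \<le> 1"
    by (simp only: of_int_le_iff)
  then have "\<bar>T\<bar> \<le> 1" by (simp add: abs_square_le_1)
  with \<open>even T\<close> have "T = 0" by (auto elim!: evenE)
  with t yz have yz: "(\<Sum>i<n. y i * z i) = 0" by simp
  have My: "(\<Sum>j<n. M i j * y j) = k * y i" and Mz: "(\<Sum>j<n. M i j * z j) = k * z i" if "i < n" for i
    using MM MN that v(1) by (simp_all add: y_def z_def)
  define D where "D i j = M i j - y i * y j - z i * z j" for i j
  txt \<open>Since \<open>M / k\<close> is a projection of trace \<open>2\<close> whose range contains \<open>y\<close> and \<open>z\<close>,
    the Frobenius norm of \<open>D\<close> is \<open>0\<close>.\<close>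
  have "(\<Sum>j<n. (D i j)^2) = k * (M i i - (y i)^2 - (z i)^2)" if "i < n" for i
  proof -
    have "(\<Sum>j<n. (D i j)^2) = (\<Sum>j<n. M i j * M j i) - 2 * y i * (\<Sum>j<n. M i j * y j)
       - 2 * z i * (\<Sum>j<n. M i j * z j) + (y i)^2 * (\<Sum>j<n. (y j)^2) + (z i)^2 * (\<Sum>j<n. (z j)^2)
       + 2 * y i * z i * (\<Sum>j<n. y j * z j)"
      unfolding sum_distrib_left sum.distrib [symmetric] sum_subtractf [symmetric]
      by (intro sum.cong) (auto simp: D_def M_sym [OF that] power2_eq_square algebra_simps)
    then show ?thesis
      unfolding MM [OF that that] My [OF that] Mz [OF that] yy zz yz
      by (simp add: power2_eq_square algebra_simps)
  qed
  then have "(\<Sum>i<n. \<Sum>j<n. (D i j)^2) = (\<Sum>i<n. k * (M i i - (y i)^2 - (z i)^2))"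
    by simp
  also have "\<dots> = k * ((\<Sum>i<n. M i i) - k - k)"
    unfolding sum_distrib_left [symmetric] sum_subtractf yy zz ..
  \<comment> \<open>The hypothesis \<open>tr\<close> says that \<open>M\<close> has trace
    \<open>2 * k\<close>, exactly the sum of the squared norms of \<open>y\<close> and
    \<open>z\<close>; nothing remains for \<open>D\<close>.\<close>
  also have "(\<Sum>i<n. M i i) = 2 * k"
  proof -
    have "(\<Sum>i<n. M i i) = trace_mat (poly_mat Mp A)"
      using poly_mat_carrier [OF A, of Mp] by (simp add: M_def E_def trace_mat_def)
    then show ?thesis
      using tr by (simp add: trace_poly_mat_proots [OF A sym] Mp_def k_def power2_eq_square)
  qed
  finally have "D i j = 0" if "i < n" "j < n" for i j
    using that by (simp add: sum_nonneg_eq_0_iff sum_nonneg)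
  then have D: "M i j = y i * y j + z i * z j" if "i < n" "j < n" for i j
    using that by (force simp: D_def)
  \<comment> \<open>Integer copies of \<open>y\<close> and \<open>z\<close>: the expression in the
    case \<open>i = v\<close> is \<open>L\<close>, by the fact \<open>L\<close>.\<close>
  define y' where "y' i = (if i = v then 1 + (\<Sum>l<n. a v l * a l v) else 0) - (\<Sum>l<n. a i l * a l v)" for i
  define z' where "z' i = (\<Sum>l<n. a i l * y' l)" for i
  have y': "y i = of_int (y' i)" if "i < n" for i
    using that v(1) by (simp add: y_def y'_def M int L)
  have z': "z i = of_int (z' i)" if "i < n" for i
    using that v(1) y' by (simp add: z_def z'_def N int flip: y_def)
  show ?thesis
  proof (rule that [of y' z'])
    show "(\<Sum>l<n. A $$ (i, l) * A $$ (l, j)) = (if i = j then L else 0) - y' i * y' j - z' i * z' j"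
      if "i < n" "j < n" for i j
      using M [OF that] D [OF that] y' z' that by simp
    show "(\<Sum>l<n. A $$ (i, l) * y' l) = z' i" if "i < n" for i
      using that by (simp add: z'_def int)
    show "(\<Sum>l<n. A $$ (i, l) * z' l) = y' i" if "i < n" for i
      using that AN [OF that v(1)] by (simp add: z' flip: y' y_def z_def)
    show "(\<Sum>i<n. (of_int (y' i))^2) = L - 1"
      using yy by (simp add: y' k_def)
    show "(\<Sum>i<n. (of_int (z' i))^2) = L - 1"
      using zz by (simp add: z' k_def)
    have "of_int (\<Sum>i<n. y' i * z' i) = (0 :: real)"
      using yz by (simp add: y' z')
    then show "(\<Sum>i<n. y' i * z' i) = 0" by linarith
    show "L > 1" using k by (simp add: k_def)
  qed
qed

section \<open>Multiplicities of the eigenvalues of a symmetric matrix with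
  \<open>A^3 = c^2 A\<close>\<close>

lemma sum_mset_three_values:
  fixes S :: "real multiset"
  assumes "set_mset S \<subseteq> {c, 0, -c}" "c \<noteq> 0"
  shows "real (size S) = count S c + count S 0 + count S (-c) \<and>
    (\<Sum>e\<in>#S. e) = c * (real (count S c) - count S (-c)) \<and>
    (\<Sum>e\<in>#S. e^2) = c^2 * (real (count S c) + count S (-c))"
  using assms
  by (induction S) (auto simp: algebra_simps)

text \<open>The cubic relation confines the eigenvalues to \<open>c\<close>, 0 and
  \<open>-c\<close>. The size of the matrix and the traces of \<open>A\<close> and
  \<open>A * A\<close> are three linear equations that determine the three multiplicities.\<close>

lemma proots_char_poly_cube:
  fixes A :: "real mat"
  assumes A: "A \<in> carrier_mat n n" and sym: "transpose_mat A = A" and n: "n = 2 * r + 1"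
    and cube: "A * (A * A) = c^2 \<cdot>\<^sub>m A" and c: "c \<noteq> 0"
    and tr: "trace_mat A = 0" "trace_mat (A * A) = 2 * real r * c^2"
  shows "proots (char_poly A) = replicate_mset r (-c) + {#0#} + replicate_mset r c"
proof -
  define S where "S = proots (char_poly A)"
  define p where "p = [:0, - (c^2), 0, 1:]"
  have X: "poly_mat ([:0, 1:] * [:0, 1:]) A = A * A"
    by (simp only: poly_mat_mult [OF A] poly_mat_X [OF A])
  have "p = [:0, 1:] * ([:0, 1:] * [:0, 1:]) + Polynomial.smult (- (c^2)) [:0, 1:]"
    by (simp add: p_def)
  then have "poly_mat p A = A * (A * A) + (- (c^2)) \<cdot>\<^sub>m A"
    by (simp only: poly_mat_add [OF A] poly_mat_mult [OF A] poly_mat_smult [OF A] poly_mat_X [OF A])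
  also have "\<dots> = 0\<^sub>m n n"
    unfolding cube using A by (auto intro!: eq_matI)
  \<comment> \<open>The trace of \<open>poly_mat (p * p) A\<close> is the sum of the squares of the
    values of \<open>p\<close> on the spectrum; as it vanishes, every eigenvalue is a root of
    \<open>p\<close>.\<close>
  finally have "trace_mat (poly_mat (p * p) A) = 0"
    by (simp add: poly_mat_mult [OF A] trace_mat_def)
  then have "(\<Sum>e\<in>#S. (poly p e)^2) = 0"
    by (simp add: trace_poly_mat_proots [OF A sym] S_def power2_eq_square)
  then have root: "poly p e = 0" if "e \<in># S" for e
    using that
  proof (induction S)
    case (add x S)
    have "(\<Sum>e\<in>#S. (poly p e)^2) \<ge> 0"
      using sum_mset_mono [of S "\<lambda>_. 0" "\<lambda>e. (poly p e)^2"] by simp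
    with add show ?case
      by (auto simp: add_nonneg_eq_0_iff)
  qed simp
  have "poly p e = e * (e - c) * (e + c)" for e
    by (simp add: p_def power2_eq_square algebra_simps)
  then have "e = c \<or> e = 0 \<or> e = -c" if "e \<in># S" for e
    using root [OF that] by (auto simp: eq_neg_iff_add_eq_0)
  then have sub: "set_mset S \<subseteq> {c, 0, -c}"
    by blast
  note three = sum_mset_three_values [OF sub c]
  have "real (size S) = real n"
    using size_proots_char_poly [OF A sym] by (simp add: S_def)
  moreover have "(\<Sum>e\<in>#S. e) = 0"
    using tr trace_poly_mat_proots [OF A sym, of "[:0, 1:]"] by (simp add: poly_mat_X [OF A] S_def)
  moreover have "(\<Sum>e\<in>#S. e^2) = 2 * real r * c^2"
    using tr trace_poly_mat_proots [OF A sym, of "[:0, 1:] * [:0, 1:]"]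
    unfolding X by (simp add: S_def power2_eq_square)
  \<comment> \<open>The first trace makes the multiplicities of \<open>c\<close> and
    \<open>-c\<close> equal, the second makes their sum \<open>2 * r\<close>, and the size leaves
    one zero eigenvalue.\<close>
  ultimately have cnt: "count S c = r" "count S 0 = 1" "count S (-c) = r"
    using three c n by (auto simp: algebra_simps)
  have "count S x = count (replicate_mset r (-c) + {#0#} + replicate_mset r c) x" for x
  proof (cases "x \<in> {c, 0, -c}")
    case True
    then show ?thesis using cnt c by auto
  next
    case False
    with sub have "x \<notin># S" by auto
    with False show ?thesis by (auto simp: not_in_iff)
  qed
  then show ?thesis
    unfolding S_def [symmetric] by (rule multiset_eqI)
qed

subsection \<open>Adding a vertex to a signed graph\<close>

lemma adj_entry_commute: "adj_entry G u w = adj_entry G w u"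
  by (simp add: adj_entry_def insert_commute)

lemma adj_entry_same:
  assumes "signed_graph G"
  shows "adj_entry G u u = 0"
proof -
  have "card {u} = 2" if "{u} \<in> edges G"
    using that assms unfolding signed_graph_def by blast
  then show ?thesis by (auto simp: adj_entry_def)
qed

lemma adj_entry_square:
  assumes "signed_graph G"
  shows "(adj_entry G u w)^2 = (if {u, w} \<in> edges G then 1 else 0)"
proof -
  have "edge_sign G {u, w} \<in> {1, -1}" if "{u, w} \<in> edges G"
    using that assms unfolding signed_graph_def by blast
  then show ?thesis by (auto simp: adj_entry_def)
qed

text \<open>Squaring removes the signs, and edges at \<open>u\<close> correspond to their other
  endpoints. The term \<open>w = u\<close> vanishes, because a singleton is not an edge.\<close>

lemma vertex_degree_eq_sum:
  assumes "signed_graph G"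
  shows "real (vertex_degree G u) = (\<Sum>w\<in>verts G. (adj_entry G u w)^2)"
proof -
  have fin: "finite (verts G)"
    and e: "\<And>e. e \<in> edges G \<Longrightarrow> e \<subseteq> verts G \<and> card e = 2"
    using assms unfolding signed_graph_def by blast+
  have "bij_betw (\<lambda>w. {u, w}) {w \<in> verts G. {u, w} \<in> edges G} {e \<in> edges G. u \<in> e}"
  proof (rule bij_betw_imageI)
    show "inj_on (\<lambda>w. {u, w}) {w \<in> verts G. {u, w} \<in> edges G}"
      by (auto simp: inj_on_def doubleton_eq_iff)
    have "e \<in> (\<lambda>w. {u, w}) ` {w \<in> verts G. {u, w} \<in> edges G}" if "e \<in> edges G" "u \<in> e" for e
    proof -
      obtain w where "e = {u, w}"
        using \<open>u \<in> e\<close> e [OF \<open>e \<in> edges G\<close>] unfolding card_2_iff by blast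
      with \<open>e \<in> edges G\<close> e [OF \<open>e \<in> edges G\<close>] show ?thesis by blast
    qed
    then show "(\<lambda>w. {u, w}) ` {w \<in> verts G. {u, w} \<in> edges G} = {e \<in> edges G. u \<in> e}"
      by blast
  qed
  then have "vertex_degree G u = card {w \<in> verts G. {u, w} \<in> edges G}"
    unfolding vertex_degree_def by (rule bij_betw_same_card [symmetric])
  also have "real \<dots> = (\<Sum>w\<in>verts G. (adj_entry G u w)^2)"
    by (simp add: adj_entry_square [OF assms] flip: sum.inter_filter [OF fin])
  finally show ?thesis .
qed

lemma the_image_Some: "the ` Some ` e = e"
  by (simp add: image_image)

text \<open>The option type supplies \<open>None\<close> as a fresh vertex. A nonzero value of
  \<open>y\<close> is the sign of a new edge, to be read off from the endpoint other than
  \<open>None\<close>; all other edges are pulled back along \<open>Some\<close>.\<close>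

definition add_vertex :: "'a signed_graph \<Rightarrow> ('a \<Rightarrow> int) \<Rightarrow> 'a option signed_graph" where
  "add_vertex G y =
     \<lparr>verts = insert None (Some ` verts G),
      edges = (`) Some ` edges G \<union> {{None, Some u} | u. u \<in> verts G \<and> y u \<noteq> 0},
      edge_sign = (\<lambda>e. if None \<in> e then y (the (the_elem (e - {None}))) else edge_sign G (the ` e))\<rparr>"

context
  fixes G :: "'a signed_graph" and y :: "'a \<Rightarrow> int"
  assumes G: "signed_graph G" and y: "\<And>u. u \<in> verts G \<Longrightarrow> y u \<in> {0, 1, -1}"
begin

lemma edge_sign_add_vertex_None: "edge_sign (add_vertex G y) {None, Some u} = y u"
proof -
  have "{None, Some u} - {None} = {Some u}" by auto
  then show ?thesis by (simp add: add_vertex_def)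
qed

lemma edge_sign_add_vertex_Some: "edge_sign (add_vertex G y) (Some ` e) = edge_sign G e"
  by (auto simp: add_vertex_def the_image_Some)

lemma signed_graph_add_vertex: "signed_graph (add_vertex G y)"
proof -
  have "edge_sign (add_vertex G y) e \<in> {1, -1}" if "e \<in> edges (add_vertex G y)" for e
  proof -
    from that consider e' where "e = Some ` e'" "e' \<in> edges G" | u where "e = {None, Some u}" "u \<in> verts G" "y u \<noteq> 0"
      by (auto simp: add_vertex_def)
    then show ?thesis
    proof cases
      case 1
      then show ?thesis using G by (auto simp: signed_graph_def edge_sign_add_vertex_Some)
    next
      case 2
      then show ?thesis using y by (auto simp: edge_sign_add_vertex_None)
    qed
  qed
  moreover have "finite (verts (add_vertex G y))"
    using G by (simp add: add_vertex_def signed_graph_def)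
  moreover have "e \<subseteq> verts (add_vertex G y) \<and> card e = 2" if "e \<in> edges (add_vertex G y)" for e
    using that G by (auto simp: add_vertex_def signed_graph_def card_image)
  ultimately show ?thesis by (simp add: signed_graph_def)
qed

lemma adj_entry_add_vertex_Some: "adj_entry (add_vertex G y) (Some u) (Some w) = adj_entry G u w"
proof -
  have "{Some u, Some w} = Some ` {u, w}" by simp
  moreover have "Some ` e \<in> edges (add_vertex G y) \<longleftrightarrow> e \<in> edges G" for e
    by (auto simp: add_vertex_def inj_image_eq_iff)
  ultimately show ?thesis
    unfolding adj_entry_def by (simp only: edge_sign_add_vertex_Some)
qed

lemma adj_entry_add_vertex_None:
  assumes "u \<in> verts G"
  shows "adj_entry (add_vertex G y) None (Some u) = y u"
proof -
  have "{None, Some u} \<in> edges (add_vertex G y) \<longleftrightarrow> y u \<noteq> 0"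
    using assms by (auto simp: add_vertex_def doubleton_eq_iff)
  then show ?thesis
    by (simp add: adj_entry_def edge_sign_add_vertex_None)
qed

lemma isomorphic_delete_add_vertex: "isomorphic (delete_vertex None (add_vertex G y)) G"
  unfolding isomorphic_def
proof (intro exI conjI)
  have e: "edges (delete_vertex None (add_vertex G y)) = (`) Some ` edges G"
    by (auto simp: delete_vertex_def add_vertex_def)
  have v: "verts (delete_vertex None (add_vertex G y)) = Some ` verts G"
    by (auto simp: delete_vertex_def add_vertex_def)
  \<comment> \<open>The isomorphism is \<open>the\<close>: once \<open>None\<close> is deleted, only
    vertices of the form \<open>Some u\<close> remain.\<close>
  show "bij_betw the (verts (delete_vertex None (add_vertex G y))) (verts G)"
    unfolding v by (auto simp: bij_betw_def inj_on_def image_image)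
  show "edges G = (`) the ` edges (delete_vertex None (add_vertex G y))"
    unfolding e by (simp add: image_image)
  show "\<forall>e\<in>edges (delete_vertex None (add_vertex G y)).
      edge_sign G (the ` e) = edge_sign (delete_vertex None (add_vertex G y)) e"
    unfolding e using edge_sign_add_vertex_Some
    by (auto simp: delete_vertex_def the_image_Some)
qed

lemma vertex_degree_add_vertex:
  "real (vertex_degree (add_vertex G y) None) = (\<Sum>u\<in>verts G. (of_int (y u))^2)"
  "u \<in> verts G \<Longrightarrow> real (vertex_degree (add_vertex G y) (Some u)) = real (vertex_degree G u) + (of_int (y u))^2"
proof -
  have fin: "finite (verts G)" using G by (simp add: signed_graph_def)
  have v: "verts (add_vertex G y) = insert None (Some ` verts G)"
    by (simp add: add_vertex_def)
  have "(\<Sum>x\<in>verts (add_vertex G y). f x) = f None + (\<Sum>u\<in>verts G. f (Some u))" for f :: "'a option \<Rightarrow> real"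
    unfolding v using fin by (subst sum.insert) (auto simp: sum.reindex)
  note deg = vertex_degree_eq_sum [OF signed_graph_add_vertex] this
  show "real (vertex_degree (add_vertex G y) None) = (\<Sum>u\<in>verts G. (of_int (y u))^2)"
    unfolding deg by (simp add: adj_entry_add_vertex_None adj_entry_same [OF signed_graph_add_vertex])
  show "real (vertex_degree (add_vertex G y) (Some u)) = real (vertex_degree G u) + (of_int (y u))^2"
    if "u \<in> verts G"
    using that unfolding deg vertex_degree_eq_sum [OF G]
    by (simp add: adj_entry_add_vertex_None adj_entry_add_vertex_Some adj_entry_commute [of _ "Some u" None])
qed

end

section \<open>The adjacency matrix and the spectrum of the extended graph\<close>

lemma adj_mat_carrier: "adj_mat G vs \<in> carrier_mat (length vs) (length vs)"
  by (simp add: adj_mat_def)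

lemma adj_mat_index:
  "i < length vs \<Longrightarrow> j < length vs \<Longrightarrow> adj_mat G vs $$ (i, j) = adj_entry G (vs ! i) (vs ! j)"
  by (simp add: adj_mat_def)

lemma transpose_adj_mat: "transpose_mat (adj_mat G vs) = adj_mat G vs"
  by (rule eq_matI) (auto simp: adj_mat_def adj_entry_commute)

lemma sum_verts_nth:
  assumes "distinct vs" "set vs = V"
  shows "(\<Sum>v\<in>V. f v) = (\<Sum>i<length vs. f (vs ! i))"
  using bij_betw_nth [OF assms(1) refl assms(2) [symmetric]]
  by (rule sum.reindex_bij_betw [symmetric])

text \<open>Bordering \<open>A\<close> by \<open>y\<close> adds \<open>y u * y w\<close> to the old
  block of the square, which cancels one of the two rank one terms in \<open>AA\<close>. The border
  of the square is \<open>A y = z\<close> and its corner is \<open>c^2 - 1\<close>, so the remaining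
  defect is the single rank one matrix of \<open>w\<close>.\<close>

lemma graph_spectrum_add_vertex:
  fixes G :: "'a signed_graph" and y z :: "'a \<Rightarrow> int" and c :: real
  assumes G: "signed_graph G" and yv: "\<And>u. u \<in> verts G \<Longrightarrow> y u \<in> {0, 1, -1}"
    and AA: "\<And>u w. u \<in> verts G \<Longrightarrow> w \<in> verts G \<Longrightarrow>
      (\<Sum>x\<in>verts G. adj_entry G u x * adj_entry G x w) = (if u = w then c^2 else 0) - y u * y w - z u * z w"
    and Ay: "\<And>u. u \<in> verts G \<Longrightarrow> (\<Sum>x\<in>verts G. adj_entry G u x * y x) = z u"
    and Az: "\<And>u. u \<in> verts G \<Longrightarrow> (\<Sum>x\<in>verts G. adj_entry G u x * z x) = y u"
    and yy: "(\<Sum>u\<in>verts G. (of_int (y u))^2) = c^2 - 1"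
    and zz: "(\<Sum>u\<in>verts G. (of_int (z u))^2) = c^2 - 1"
    and yz: "(\<Sum>u\<in>verts G. y u * z u) = 0"
    and c: "c \<noteq> 0" and n: "card (verts G) = 2 * r"
  shows "graph_spectrum (add_vertex G y) = replicate_mset r (-c) + {#0#} + replicate_mset r c"
proof -
  let ?H = "add_vertex G y"
  obtain vs where vs: "distinct vs" "set vs = verts G"
    using G finite_distinct_list unfolding signed_graph_def by metis
  define ws where "ws = None # map Some vs"
  have ws: "distinct ws" "set ws = verts ?H"
    using vs by (auto simp: ws_def distinct_map add_vertex_def)
  have fin: "finite (verts G)" using G by (simp add: signed_graph_def)
  have sumH: "(\<Sum>x\<in>verts ?H. f x) = f None + (\<Sum>u\<in>verts G. f (Some u))" for f :: "'a option \<Rightarrow> real"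
    using fin by (simp add: add_vertex_def sum.reindex)
  have vH: "verts ?H = insert None (Some ` verts G)"
    by (simp add: add_vertex_def)
  let ?a = "adj_entry ?H"
  note adj = adj_entry_add_vertex_Some [OF G yv] adj_entry_add_vertex_None [OF G yv]
    adj_entry_same [OF signed_graph_add_vertex [OF G yv]]
  txt \<open>\<open>w\<close> spans the kernel of the adjacency matrix of the extended graph.\<close>
  define w where "w x = (case x of None \<Rightarrow> -1 | Some u \<Rightarrow> real_of_int (z u))" for x
  have adj': "?a (Some u) None = y u" if "u \<in> verts G" for u
    using that by (simp add: adj_entry_commute [of _ _ None] adj)
  have yz': "(\<Sum>u\<in>verts G. real_of_int (y u) * real_of_int (z u)) = 0"
    using arg_cong [OF yz, of real_of_int] by simp
  have yA: "(\<Sum>x\<in>verts G. y x * adj_entry G x u) = z u" if "u \<in> verts G" for u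
    using Ay [OF that] by (simp add: adj_entry_commute [of G _ u] mult.commute)
  \<comment> \<open>At \<open>None\<close> the sum is the inner product of \<open>y\<close> and
    \<open>z\<close>; at \<open>Some u\<close> the summand \<open>- y u\<close> from the new vertex
    cancels against \<open>Az\<close>.\<close>
  have Hw: "(\<Sum>x\<in>verts ?H. ?a u x * w x) = 0" if "u \<in> verts ?H" for u
    using that [unfolded vH] yz' unfolding sumH by (auto simp: w_def adj adj' Az)
  have HH: "(\<Sum>x\<in>verts ?H. ?a u x * ?a x v) = (if u = v then c^2 else 0) - w u * w v"
    if uv: "u \<in> verts ?H" "v \<in> verts ?H" for u v
  proof -
    from uv [unfolded vH] consider "u = None" "v = None"
      | b where "u = None" "v = Some b" "b \<in> verts G"
      | a where "u = Some a" "v = None" "a \<in> verts G"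
      | a b where "u = Some a" "v = Some b" "a \<in> verts G" "b \<in> verts G"
      by blast
    then show ?thesis
      unfolding sumH by cases (simp_all add: w_def adj adj' AA Ay yA yy flip: power2_eq_square)
  qed
  define A where "A = adj_mat ?H ws"
  define N where "N = length ws"
  have A: "A \<in> carrier_mat N N"
    unfolding A_def N_def by (rule adj_mat_carrier)
  have wsv: "ws ! i \<in> verts ?H" if "i < N" for i
    using that ws by (auto simp: N_def simp flip: ws(2))
  have Aij: "A $$ (i, j) = ?a (ws ! i) (ws ! j)" if "i < N" "j < N" for i j
    using that by (simp add: A_def N_def adj_mat_index)
  have AA: "(A * A) $$ (i, j) = (if i = j then c^2 else 0) - w (ws ! i) * w (ws ! j)" if "i < N" "j < N" for i j
    using that HH [OF wsv [OF that(1)] wsv [OF that(2)]] sum_verts_nth [OF ws, of "\<lambda>x. ?a (ws ! i) x * ?a x (ws ! j)"] ws(1)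
    by (simp add: index_mult_mat_sum [OF A A] Aij N_def [symmetric] nth_eq_iff_index_eq del: index_mult_mat(1))
  have sumN: "(\<Sum>i<N. f (ws ! i)) = (\<Sum>x\<in>verts ?H. f x)" for f :: "'a option \<Rightarrow> real"
    unfolding N_def by (rule sum_verts_nth [OF ws, symmetric])
  have "proots (char_poly A) = replicate_mset r (-c) + {#0#} + replicate_mset r c"
  proof (rule proots_char_poly_cube [OF A _ _ _ c])
    show "transpose_mat A = A"
      unfolding A_def by (rule transpose_adj_mat)
    show N: "N = 2 * r + 1"
      using n distinct_card [OF vs(1)] vs(2) by (simp add: N_def ws_def)
    show "trace_mat A = 0"
      using A by (simp add: trace_mat_def Aij adj)
    have "trace_mat (A * A) = (\<Sum>i<N. c^2) - (\<Sum>i<N. (w (ws ! i))^2)"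
      using A by (simp add: trace_mat_def AA power2_eq_square sum_subtractf del: index_mult_mat(1))
    \<comment> \<open>The new vertex contributes 1 to the squared norm of \<open>w\<close>, and
      \<open>z\<close> contributes \<open>c^2 - 1\<close>. Thus one of the \<open>2 * r + 1\<close>
      diagonal terms \<open>c^2\<close> is lost.\<close>
    also have "(\<Sum>i<N. (w (ws ! i))^2) = c^2"
      by (subst sumN) (simp add: sumH w_def zz)
    finally show "trace_mat (A * A) = 2 * real r * c^2"
      by (simp add: N algebra_simps)
    have AAc: "A * A \<in> carrier_mat N N" using A by simp
    show "A * (A * A) = c^2 \<cdot>\<^sub>m A"
    proof (rule eq_matI)
      fix i j
      assume "i < dim_row (c^2 \<cdot>\<^sub>m A)" "j < dim_col (c^2 \<cdot>\<^sub>m A)"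
      then have ij: "i < N" "j < N" using A by auto
      \<comment> \<open>Multiplying the formula for \<open>A * A\<close> by \<open>A\<close> gives
        \<open>c^2\<close> times \<open>A\<close> minus a product with the factor
        \<open>A w\<close>, which is zero by \<open>Hw\<close>.\<close>
      have "(A * (A * A)) $$ (i, j) =
          (\<Sum>l<N. (if l = j then c^2 * A $$ (i, l) else 0)) - (\<Sum>l<N. ?a (ws ! i) (ws ! l) * w (ws ! l)) * w (ws ! j)"
        unfolding index_mult_mat_sum [OF A AAc ij] sum_distrib_right sum_subtractf [symmetric]
        by (intro sum.cong) (use ij in \<open>auto simp: AA Aij algebra_simps simp del: index_mult_mat(1)\<close>)
      also have "(\<Sum>l<N. ?a (ws ! i) (ws ! l) * w (ws ! l)) = 0"
        by (subst sumN) (rule Hw [OF wsv [OF ij(1)]])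
      finally show "(A * (A * A)) $$ (i, j) = (c^2 \<cdot>\<^sub>m A) $$ (i, j)"
        using ij A by simp
    qed (use A in auto)
  qed
  then show ?thesis
    by (simp add: graph_spectrum_eq [OF ws] A_def)
qed

section \<open>Transfer between matrix indices and vertices, and the degrees of the
  extension\<close>

theorem theorem5p4:
  fixes G :: "'a signed_graph" and lam :: real and m :: nat
  assumes "signed_graph G"
    and "m \<ge> 2"
    and "graph_spectrum G =
           replicate_mset (m - 2) (-lam) + {#-1#} + {#1#} + replicate_mset (m - 2) lam"
    and "\<forall>v\<in>verts G. real (vertex_degree G v) \<in> {lam^2, lam^2 - 1, lam^2 - 2}"
    and "\<exists>v\<in>verts G. real (vertex_degree G v) = lam^2 - 1"
  shows "\<exists>H :: 'a option signed_graph.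
           signed_graph H \<and>
           graph_spectrum H = replicate_mset (m - 1) (-lam) + {#0#} + replicate_mset (m - 1) lam \<and>
           (\<forall>v\<in>verts H. real (vertex_degree H v) \<in> {lam^2, lam^2 - 1}) \<and>
           (\<exists>v\<in>verts H. isomorphic (delete_vertex v H) G)"
proof -
  note G = assms(1)
  obtain vs where vs: "distinct vs" "set vs = verts G"
    using G finite_distinct_list unfolding signed_graph_def by metis
  define n where "n = length vs"
  define A where "A = adj_mat G vs"
  have A: "A \<in> carrier_mat n n" and sym: "transpose_mat A = A"
    unfolding A_def n_def by (rule adj_mat_carrier, rule transpose_adj_mat)
  have Aij: "A $$ (i, j) = adj_entry G (vs ! i) (vs ! j)" if "i < n" "j < n" for i j
    using that by (simp add: A_def n_def adj_mat_index)
  have vsv: "vs ! i \<in> verts G" if "i < n" for i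
    using that by (auto simp: n_def simp flip: vs(2))
  have idx: "\<exists>i<n. u = vs ! i" if "u \<in> verts G" for u
    using that by (auto simp: n_def in_set_conv_nth simp flip: vs(2))
  have sumV: "(\<Sum>v\<in>verts G. f v) = (\<Sum>i<n. f (vs ! i))" for f :: "'a \<Rightarrow> 'b :: comm_monoid_add"
    unfolding n_def by (rule sum_verts_nth [OF vs])
  have deg: "real (vertex_degree G u) = (\<Sum>w\<in>verts G. adj_entry G u w * adj_entry G w u)" for u
    unfolding vertex_degree_eq_sum [OF G] by (simp add: adj_entry_commute [of G _ u] power2_eq_square)
  have spec: "proots (char_poly A) =
      replicate_mset (m - 2) (-lam) + {#-1#} + {#1#} + replicate_mset (m - 2) lam"
    using assms(3) graph_spectrum_eq [OF vs] by (simp add: A_def)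
  \<comment> \<open>The spectrum has \<open>2 * (m - 2) + 2\<close> members;
    \<open>m \<ge> 2\<close> keeps the natural subtraction exact.\<close>
  have n: "n = 2 * (m - 1)"
    using size_proots_char_poly [OF A sym] assms(2) unfolding spec by simp
  obtain v where v: "v < n" "real (vertex_degree G (vs ! v)) = lam^2 - 1"
    using assms(5) idx by blast
  define a :: "nat \<Rightarrow> nat \<Rightarrow> int" where
    "a i j = (if {vs ! i, vs ! j} \<in> edges G then edge_sign G {vs ! i, vs ! j} else 0)" for i j
  have int: "A $$ (i, j) = of_int (a i j)" if "i < n" "j < n" for i j
    using that by (simp add: Aij a_def adj_entry_def)
  have diag: "A $$ (i, i) = 0" if "i < n" for i
    using that by (simp add: Aij adj_entry_same [OF G])
  have eigen: "e^2 = lam^2 \<or> e^2 = 1" if "e \<in># proots (char_poly A)" for e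
    using that unfolding spec by (auto split: if_splits)
  \<comment> \<open>Only the two eigenvalues 1 and -1 contribute, each with
    \<open>lam^2 - 1\<close>.\<close>
  have trace: "(\<Sum>e\<in>#proots (char_poly A). lam^2 - e^2) = 2 * (lam^2 - 1)"
    unfolding spec by simp
  have AAv: "(A * A) $$ (v, v) = lam^2 - 1"
    using v by (simp add: index_mult_mat_sum [OF A A] Aij deg sumV del: index_mult_mat(1))
  obtain y' z' :: "nat \<Rightarrow> int" where
    AA: "\<And>i j. i < n \<Longrightarrow> j < n \<Longrightarrow>
      (\<Sum>l<n. A $$ (i, l) * A $$ (l, j)) = (if i = j then lam^2 else 0) - y' i * y' j - z' i * z' j"
    and Ay: "\<And>i. i < n \<Longrightarrow> (\<Sum>l<n. A $$ (i, l) * y' l) = z' i"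
    and Az: "\<And>i. i < n \<Longrightarrow> (\<Sum>l<n. A $$ (i, l) * z' l) = y' i"
    and yy: "(\<Sum>i<n. (of_int (y' i))^2) = lam^2 - 1"
    and zz: "(\<Sum>i<n. (of_int (z' i))^2) = lam^2 - 1"
    and yz: "(\<Sum>i<n. y' i * z' i) = 0"
    and lam: "lam^2 > 1"
    using rank_two_complement_of_square [OF A sym int diag eigen trace v(1) AAv] by blast
  have AA': "(\<Sum>l<n. adj_entry G (vs ! i) (vs ! l) * adj_entry G (vs ! l) (vs ! j)) =
      (if i = j then lam^2 else 0) - y' i * y' j - z' i * z' j" if "i < n" "j < n" for i j
    using AA [OF that] that by (simp add: Aij)
  have Ay': "(\<Sum>l<n. adj_entry G (vs ! i) (vs ! l) * y' l) = z' i"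
    and Az': "(\<Sum>l<n. adj_entry G (vs ! i) (vs ! l) * z' l) = y' i" if "i < n" for i
    using Ay [OF that] Az [OF that] that by (simp_all add: Aij)
  define ix where "ix = inv_into {..<n} ((!) vs)"
  have ix: "ix (vs ! i) = i" if "i < n" for i
    using that vs(1) unfolding ix_def n_def by (intro inv_into_f_f inj_on_nth) auto
  define y where "y u = y' (ix u)" for u
  define z where "z u = z' (ix u)" for u
  let ?H = "add_vertex G y"
  \<comment> \<open>The degree is a diagonal entry of the square of \<open>A\<close>, so this is the
    diagonal of \<open>AA'\<close>.\<close>
  have degG: "real (vertex_degree G u) = lam^2 - of_int (y u ^ 2 + z u ^ 2)" if "u \<in> verts G" for u
  proof -
    obtain i where i: "i < n" "u = vs ! i" using idx \<open>u \<in> verts G\<close> by blast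
    then show ?thesis
      using AA' [of i i] by (simp add: deg sumV y_def z_def ix power2_eq_square)
  qed
  have yz_cases: "y u \<in> {0, 1, -1} \<and> (z u)^2 \<in> {0, 1}" if "u \<in> verts G" for u
  proof -
    \<comment> \<open>The lower bound \<open>lam^2 - 2\<close> on the degrees bounds the sum of the
      two squares by 2, which forces integers into 0, 1 and -1. This is what makes \<open>y\<close>
      an admissible sign vector.\<close>
    have "(of_int (y u ^ 2 + z u ^ 2) :: real) \<le> of_int 2"
      using assms(4) that degG [OF that] by auto
    then have *: "y u ^ 2 + z u ^ 2 \<le> 2"
      by (simp only: of_int_le_iff)
    have abs: "\<bar>x\<bar> \<le> 1" if "x^2 \<le> 2" for x :: int
    proof (rule ccontr)
      assume "\<not> \<bar>x\<bar> \<le> 1"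
      then have "2^2 \<le> \<bar>x\<bar>^2" by (intro power_mono) auto
      with that show False by simp
    qed
    have "y u ^ 2 \<ge> 0" "z u ^ 2 \<ge> 0" by simp_all
    with * have "y u ^ 2 \<le> 2" "z u ^ 2 \<le> 2" by linarith+
    then have "\<bar>y u\<bar> \<le> 1" "\<bar>z u\<bar> \<le> 1" by (auto intro!: abs)
    then have "y u \<in> {0, 1, -1}" "z u \<in> {0, 1, -1}" by auto
    then show ?thesis by auto
  qed
  then have yv: "y u \<in> {0, 1, -1}" if "u \<in> verts G" for u
    using that by blast
  show ?thesis
  proof (intro exI conjI)
    show "signed_graph ?H"
      by (rule signed_graph_add_vertex [OF G yv])
    show "graph_spectrum ?H = replicate_mset (m - 1) (-lam) + {#0#} + replicate_mset (m - 1) lam"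
    proof (rule graph_spectrum_add_vertex [OF G yv, where z = z])
      show "(\<Sum>x\<in>verts G. adj_entry G u x * adj_entry G x w) =
          (if u = w then lam^2 else 0) - y u * y w - z u * z w" if "u \<in> verts G" "w \<in> verts G" for u w
      proof -
        obtain i j where ij: "i < n" "u = vs ! i" "j < n" "w = vs ! j"
          using idx [OF \<open>u \<in> verts G\<close>] idx [OF \<open>w \<in> verts G\<close>] by blast
        then have "u = w \<longleftrightarrow> i = j" using vs(1) by (simp add: n_def nth_eq_iff_index_eq)
        then show ?thesis
          using AA' [of i j] ij by (simp add: sumV y_def z_def ix)
      qed
      show "(\<Sum>x\<in>verts G. adj_entry G u x * y x) = z u"
        "(\<Sum>x\<in>verts G. adj_entry G u x * z x) = y u" if "u \<in> verts G" for u
        using idx [OF that] Ay' Az' by (auto simp: sumV y_def z_def ix)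
      show "(\<Sum>u\<in>verts G. (of_int (y u))^2) = lam^2 - 1" "(\<Sum>u\<in>verts G. (of_int (z u))^2) = lam^2 - 1"
        "(\<Sum>u\<in>verts G. y u * z u) = 0"
        using yy zz yz by (simp_all add: sumV y_def z_def ix)
      show "lam \<noteq> 0" using lam by auto
      show "card (verts G) = 2 * (m - 1)"
        using n distinct_card [OF vs(1)] vs(2) by (simp add: n_def)
    qed
    show "\<forall>v\<in>verts ?H. real (vertex_degree ?H v) \<in> {lam^2, lam^2 - 1}"
    proof
      fix x assume "x \<in> verts ?H"
      then consider "x = None" | u where "x = Some u" "u \<in> verts G"
        by (auto simp: add_vertex_def)
      then show "real (vertex_degree ?H x) \<in> {lam^2, lam^2 - 1}"
      proof cases
        case 1
        \<comment> \<open>The degree of the new vertex is the squared norm of \<open>y\<close>,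
          which is \<open>lam^2 - 1\<close>.\<close>
        then show ?thesis
          using yy by (simp add: vertex_degree_add_vertex [OF G yv] sumV y_def ix)
      next
        case 2
        \<comment> \<open>The edge to the new vertex restores the term \<open>y u ^ 2\<close>
          missing in \<open>degG\<close>, and only \<open>z u ^ 2\<close> remains as a
          defect.\<close>
        then have "real (vertex_degree ?H x) = lam^2 - of_int (z u ^ 2)"
          by (simp add: vertex_degree_add_vertex [OF G yv] degG)
        with yz_cases [OF 2(2)] show ?thesis by (auto simp flip: of_int_power)
      qed
    qed
    show "\<exists>v\<in>verts ?H. isomorphic (delete_vertex v ?H) G"
      by (rule bexI [of _ None]) (use isomorphic_delete_add_vertex [OF G yv] in \<open>auto simp: add_vertex_def\<close>)
  qed
qed

end
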